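(* Let $a\in\{1,\dots,D\}$. If $T_aG$ and $G$ admit block Cholesky factorizations, then one has the (block) $LU$ factorization $$n_a\cdot J-q_a=M_a\,\omega_a$$ and the (block) $UL$ factorization $$T_a(n_a\cdot J)-q_a=\omega_a\,M_a.$$
   Context: Let $D\ge 1$. For $k\in\mathbb Z_+$ let $[k]=\{\alpha\in\mathbb Z_+^D:|\alpha|=k\}$, ordered so that $\alpha>\alpha'$ iff at the first coordinate where they differ the entry of $\alpha$ is smaller. $\chi_{[k]}(x)$ is the column vector of monomials $x^\alpha$, $\alpha\in[k]$, and $\chi$ stacks $\chi_{[0]},\chi_{[1]},\dots$. Semi-infinite matrices are partitioned in blocks $A_{[k],[\ell]}\in\mathbb R^{|[k]|\times|[\ell]|}$. Shift matrices: $\Lambda_b$, $b=1,\dots,D$, has as only nonzero blocks $(\Lambda_b)_{[k],[k+1]}$, with entries $\delta_{\alpha+e_b,\alpha'}$, $\alpha\in[k]$, $\alpha'\in[k+1]$; $n\cdot\Lambda=\sum_bn_b\Lambda_b$. Discrete flows: fix an invertible $N=(n_{a,b})\in GL(\mathbb R^D)$, $n_a=(n_{a,1},\dots,n_{a,D})^\top$, and $q\in\mathbb R^D$ with all $q_a\ne0$. Let $\mu$ be a Borel measure with finite moments and support in $\{x:|n_a\cdot x|<|q_a|,\ a=1,\dots,D\}$. For $m\in\mathbb Z^D$, $d\mu_m(x)=\big[\prod_a(n_a\cdot x-q_a)^{m_a}\big]d\mu(x)$ has moment matrix $G(m)=\int\chi\,d\mu_m\,\chi^\top$. A block Cholesky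 factorization is $G(m)=S(m)^{-1}H(m)(S(m)^{-1})^\top$ with $S(m)$ block lower triangular with identity diagonal blocks and $H(m)$ block diagonal with invertible diagonal blocks. $(T_af)(m)=f(m+e_a)$; the dependence on $m$ is omitted. Jacobi type matrices: $J_b=S\Lambda_bS^{-1}$, $n\cdot J=\sum_bn_bJ_b$. $M_a=S(T_aS)^{-1}$ (block lower triangular with identity diagonal blocks). Lattice resolvent: $\omega_a=(T_aH)M_a^\top H^{-1}$ (block upper triangular). A scalar such as $q_a$ stands for $q_a$ times the identity. *)

theory Defs
  imports "HOL-Analysis.Analysis"
begin

section \<open>Multi-indices and semi-infinite matrices\<close>

text \<open>
  The dimension is \<^term>\<open>CARD('d)\<close>.  Semi-infinite matrices are indexed directly by
  multi-indices; the graded order only says how rows and columns are arranged on paper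
  inside a block, and no notion below depends on it.
\<close>

type_synonym 'd midx = "nat ^ 'd"

type_synonym 'd smat = "nat ^ 'd \<Rightarrow> nat ^ 'd \<Rightarrow> real"

definition mdeg :: "'d::finite midx \<Rightarrow> nat" where
  "mdeg \<alpha> = (\<Sum>i\<in>UNIV. \<alpha> $ i)"

definition midx_of_deg :: "nat \<Rightarrow> 'd::finite midx set" where
  "midx_of_deg k = {\<alpha>. mdeg \<alpha> = k}"

definition monomial :: "'d::finite midx \<Rightarrow> real ^ 'd \<Rightarrow> real" where
  "monomial \<alpha> x = (\<Prod>i\<in>UNIV. (x $ i) ^ (\<alpha> $ i))"

definition smat_scalar :: "real \<Rightarrow> 'd smat" where
  "smat_scalar c = (\<lambda>\<alpha> \<beta>. if \<alpha> = \<beta> then c else 0)"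

definition smat_transpose :: "'d smat \<Rightarrow> 'd smat" where
  "smat_transpose A = (\<lambda>\<alpha> \<beta>. A \<beta> \<alpha>)"

text \<open>
  A product of semi-infinite matrices makes sense when every entry is a sum with only
  finitely many nonzero terms.  Outside this situation the value of \<open>smat_mult\<close>
  is meaningless (the entry is then 0, as for every \<^const>\<open>sum\<close> over an infinite set).
\<close>

definition smat_mult_defined :: "'d smat \<Rightarrow> 'd smat \<Rightarrow> bool" where
  "smat_mult_defined A B \<longleftrightarrow> (\<forall>\<alpha> \<beta>. finite {\<gamma>. A \<alpha> \<gamma> * B \<gamma> \<beta> \<noteq> 0})"

definition smat_mult :: "'d smat \<Rightarrow> 'd smat \<Rightarrow> 'd smat" (infixl "\<odot>" 70) where
  "A \<odot> B = (\<lambda>\<alpha> \<beta>. \<Sum>\<gamma> | A \<alpha> \<gamma> * B \<gamma> \<beta> \<noteq> 0. A \<alpha> \<gamma> * B \<gamma> \<beta>)"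

text \<open>
  Two-sided inverse, in the style of \<^const>\<open>matrix_inv\<close>.  It is only applied to block lower
  unitriangular matrices and to block diagonal matrices with invertible diagonal blocks.
  For these a two-sided inverse exists and is unique: their rows are finite, so the right
  inverse is already unique.
\<close>

definition smat_inv :: "'d smat \<Rightarrow> 'd smat" where
  "smat_inv A = (SOME B. smat_mult_defined A B \<and> smat_mult_defined B A
      \<and> A \<odot> B = smat_scalar 1 \<and> B \<odot> A = smat_scalar 1)"

definition block_lower :: "'d::finite smat \<Rightarrow> bool" where
  "block_lower A \<longleftrightarrow>
     (\<forall>k l. k < l \<longrightarrow> (\<forall>\<alpha>\<in>midx_of_deg k. \<forall>\<beta>\<in>midx_of_deg l. A \<alpha> \<beta> = 0))"

definition block_upper :: "'d::finite smat \<Rightarrow> bool" where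
  "block_upper A \<longleftrightarrow>
     (\<forall>k l. l < k \<longrightarrow> (\<forall>\<alpha>\<in>midx_of_deg k. \<forall>\<beta>\<in>midx_of_deg l. A \<alpha> \<beta> = 0))"

definition block_diagonal :: "'d::finite smat \<Rightarrow> bool" where
  "block_diagonal A \<longleftrightarrow>
     (\<forall>k l. k \<noteq> l \<longrightarrow> (\<forall>\<alpha>\<in>midx_of_deg k. \<forall>\<beta>\<in>midx_of_deg l. A \<alpha> \<beta> = 0))"

definition block_lower_unitriangular :: "'d::finite smat \<Rightarrow> bool" where
  "block_lower_unitriangular A \<longleftrightarrow> block_lower A \<and>
     (\<forall>k. \<forall>\<alpha>\<in>midx_of_deg k. \<forall>\<beta>\<in>midx_of_deg k. A \<alpha> \<beta> = (if \<alpha> = \<beta> then 1 else 0))"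

definition invertible_diag_block :: "'d::finite smat \<Rightarrow> nat \<Rightarrow> bool" where
  "invertible_diag_block A k \<longleftrightarrow> (\<exists>B :: 'd smat. \<forall>\<alpha>\<in>midx_of_deg k. \<forall>\<beta>\<in>midx_of_deg k.
      (\<Sum>\<gamma>\<in>midx_of_deg k. A \<alpha> \<gamma> * B \<gamma> \<beta>) = (if \<alpha> = \<beta> then 1 else 0) \<and>
      (\<Sum>\<gamma>\<in>midx_of_deg k. B \<alpha> \<gamma> * A \<gamma> \<beta>) = (if \<alpha> = \<beta> then 1 else 0))"

definition block_cholesky :: "'d::finite smat \<Rightarrow> 'd smat \<Rightarrow> 'd smat \<Rightarrow> bool" where
  "block_cholesky G S H \<longleftrightarrow>
     block_lower_unitriangular S \<and>
     block_diagonal H \<and> (\<forall>k. invertible_diag_block H k) \<and>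
     G = smat_inv S \<odot> H \<odot> smat_transpose (smat_inv S)"

text \<open>
  The product in a \<open>UL\<close> factorization need not be defined for arbitrary block triangular
  factors, hence the explicit requirement.
\<close>

definition block_LU :: "'d::finite smat \<Rightarrow> 'd smat \<Rightarrow> 'd smat \<Rightarrow> bool" where
  "block_LU A L U \<longleftrightarrow> block_lower_unitriangular L \<and> block_upper U \<and>
     smat_mult_defined L U \<and> A = L \<odot> U"

definition block_UL :: "'d::finite smat \<Rightarrow> 'd smat \<Rightarrow> 'd smat \<Rightarrow> bool" where
  "block_UL A U L \<longleftrightarrow> block_upper U \<and> block_lower_unitriangular L \<and>
     smat_mult_defined U L \<and> A = U \<odot> L"

definition Lambda :: "'d::finite \<Rightarrow> 'd smat" where
  "Lambda b = (\<lambda>\<alpha> \<alpha>'. if \<alpha> + axis b 1 = \<alpha>' then 1 else 0)"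

section \<open>Measures and discrete flows\<close>

definition measure_support :: "'a::topological_space measure \<Rightarrow> 'a set" where
  "measure_support \<mu> = {x. \<forall>U. open U \<and> x \<in> U \<longrightarrow> emeasure \<mu> U \<noteq> 0}"

definition finite_moments :: "(real ^ 'd::finite) measure \<Rightarrow> bool" where
  "finite_moments \<mu> \<longleftrightarrow> (\<forall>\<alpha>. integrable \<mu> (monomial \<alpha>))"

text \<open>
  The rows \<open>N $ a\<close> are the vectors \<open>n\<^sub>a\<close>.  The deformed measure \<open>\<mu>\<^sub>m\<close> has density
  \<open>deformation N q m\<close> with respect to \<open>\<mu>\<close>.  This density may be negative, so it is
  kept inside the integral defining the moment matrix.
\<close>

definition deformation :: "real ^ 'd ^ 'd \<Rightarrow> real ^ 'd \<Rightarrow> int ^ 'd \<Rightarrow> real ^ 'd::finite \<Rightarrow> real" where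
  "deformation N q m x = (\<Prod>a\<in>UNIV. (N $ a \<bullet> x - q $ a) powi (m $ a))"

definition moment_matrix ::
  "(real ^ 'd) measure \<Rightarrow> real ^ 'd ^ 'd \<Rightarrow> real ^ 'd \<Rightarrow> int ^ 'd \<Rightarrow> 'd::finite smat" where
  "moment_matrix \<mu> N q m =
     (\<lambda>\<alpha> \<beta>. \<integral>x. monomial \<alpha> x * monomial \<beta> x * deformation N q m x \<partial>\<mu>)"

definition shift :: "'d::finite \<Rightarrow> (int ^ 'd \<Rightarrow> 'b) \<Rightarrow> int ^ 'd \<Rightarrow> 'b" where
  "shift a f = (\<lambda>m. f (m + axis a 1))"

definition jacobi :: "'d::finite \<Rightarrow> (int ^ 'd \<Rightarrow> 'd smat) \<Rightarrow> int ^ 'd \<Rightarrow> 'd smat" where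
  "jacobi b S = (\<lambda>m. S m \<odot> Lambda b \<odot> smat_inv (S m))"

definition dot_jacobi ::
  "real ^ 'd \<Rightarrow> (int ^ 'd \<Rightarrow> 'd smat) \<Rightarrow> int ^ 'd \<Rightarrow> 'd::finite smat" where
  "dot_jacobi n S = (\<lambda>m \<alpha> \<beta>. \<Sum>b\<in>UNIV. n $ b * jacobi b S m \<alpha> \<beta>)"

definition M_matrix :: "'d::finite \<Rightarrow> (int ^ 'd \<Rightarrow> 'd smat) \<Rightarrow> int ^ 'd \<Rightarrow> 'd smat" where
  "M_matrix a S = (\<lambda>m. S m \<odot> smat_inv (shift a S m))"

definition lattice_resolvent ::
  "'d::finite \<Rightarrow> (int ^ 'd \<Rightarrow> 'd smat) \<Rightarrow> (int ^ 'd \<Rightarrow> 'd smat) \<Rightarrow> int ^ 'd \<Rightarrow> 'd smat" where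
  "lattice_resolvent a S H =
     (\<lambda>m. shift a H m \<odot> smat_transpose (M_matrix a S m) \<odot> smat_inv (H m))"

end

theory Submission
  imports Defs
begin

text \<open>
  Multiplying the measure by \<open>n\<^sub>a \<cdot> x - q\<^sub>a\<close> gives \<open>T\<^sub>a G = L G\<close> with
  \<open>L = n\<^sub>a \<cdot> \<Lambda> - q\<^sub>a\<close>; the support condition makes the support compact and keeps it away
  from the poles of the deformation, so all deformed moments exist.
  Write \<open>A = S\<^sup>-\<^sup>1\<close>, \<open>S' = T\<^sub>a S\<close>, \<open>H' = T\<^sub>a H\<close> and \<open>A' = S'\<^sup>-\<^sup>1\<close>, so that \<open>M\<^sub>a = S A'\<close>.
  Inserting the Cholesky factorizations, \<open>A' H' A'\<^sup>T = L A H A\<^sup>T\<close>, hence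
  \<open>\<omega>\<^sub>a = H' A'\<^sup>T S\<^sup>T H\<^sup>-\<^sup>1 = S' L A\<close>.  Then \<open>M\<^sub>a \<omega>\<^sub>a = S A' S' L A = S L A\<close> and
  \<open>\<omega>\<^sub>a M\<^sub>a = S' L A S A' = S' L A'\<close>.  Products of semi-infinite matrices are not
  associative in general; here this is harmless because \<open>S\<close>, \<open>S'\<close>, \<open>A\<close>, \<open>A'\<close>, \<open>L\<close>, \<open>H\<close> and \<open>H'\<close> all have
  finite rows.
\<close>

section \<open>Row-finite matrices\<close>

text \<open>Finite rows in the left factor alone make a product defined, whatever the right factor
  is. Column-finiteness is expressed through the transpose.\<close>

definition row_finite :: "'d smat \<Rightarrow> bool" where
  "row_finite A \<longleftrightarrow> (\<forall>\<alpha>. finite {\<gamma>. A \<alpha> \<gamma> \<noteq> 0})"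

text \<open>The sum in \<open>smat_mult\<close> runs over a support that changes from entry to
  entry; any finite superset gives the same value, so several entries can share one index
  set.\<close>

lemma smat_mult_eq_sum:
  assumes "finite F" and "\<And>\<gamma>. \<gamma> \<notin> F \<Longrightarrow> A \<alpha> \<gamma> * B \<gamma> \<beta> = 0"
  shows "(A \<odot> B) \<alpha> \<beta> = (\<Sum>\<gamma>\<in>F. A \<alpha> \<gamma> * B \<gamma> \<beta>)"
  unfolding smat_mult_def by (rule sum.mono_neutral_left) (use assms in auto)

lemma smat_mult_row_finite:
  assumes "row_finite A"
  shows "(A \<odot> B) \<alpha> \<beta> = (\<Sum>\<gamma> | A \<alpha> \<gamma> \<noteq> 0. A \<alpha> \<gamma> * B \<gamma> \<beta>)"
  by (rule smat_mult_eq_sum) (use assms in \<open>auto simp: row_finite_def\<close>)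

lemma smat_mult_defined_row_finite: "row_finite A \<Longrightarrow> smat_mult_defined A B"
  unfolding row_finite_def smat_mult_defined_def by (auto elim!: rev_finite_subset)

lemma row_finite_mult:
  assumes A: "row_finite A" and B: "row_finite B"
  shows "row_finite (A \<odot> B)"
  unfolding row_finite_def
proof
  fix \<alpha>
  have "{\<delta>. (A \<odot> B) \<alpha> \<delta> \<noteq> 0} \<subseteq> (\<Union>\<gamma>\<in>{\<gamma>. A \<alpha> \<gamma> \<noteq> 0}. {\<delta>. B \<gamma> \<delta> \<noteq> 0})"
    by (auto simp: smat_mult_row_finite[OF A] elim!: sum.not_neutral_contains_not_neutral)
  then show "finite {\<delta>. (A \<odot> B) \<alpha> \<delta> \<noteq> 0}"
    by (rule finite_subset) (use A B in \<open>auto simp: row_finite_def\<close>)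
qed

text \<open>From row \<alpha> only finitely many indices are reached through \<open>A\<close>, and
  then through \<open>B\<close>, so both bracketings are the same finite double sum.\<close>

lemma smat_mult_assoc:
  assumes A: "row_finite A" and B: "row_finite B"
  shows "(A \<odot> B) \<odot> C = A \<odot> (B \<odot> C)"
proof (intro ext)
  fix \<alpha> \<beta>
  define F where "F = {\<gamma>. A \<alpha> \<gamma> \<noteq> 0}"
  \<comment> \<open>The indices reached through \<open>A\<close> and then \<open>B\<close>; they
    contain the support of row \<alpha> of \<open>A \<odot> B\<close> and of every row of
    \<open>B\<close> indexed by \<open>F\<close>.\<close>
  define F' where "F' = (\<Union>\<gamma>\<in>F. {\<delta>. B \<gamma> \<delta> \<noteq> 0})"
  have F: "finite F" and F': "finite F'"
    using A B by (auto simp: F_def F'_def row_finite_def)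
  have AB: "(A \<odot> B) \<alpha> \<delta> = (\<Sum>\<gamma>\<in>F. A \<alpha> \<gamma> * B \<gamma> \<delta>)" for \<delta>
    unfolding F_def by (rule smat_mult_row_finite[OF A])
  have BC: "(B \<odot> C) \<gamma> \<beta> = (\<Sum>\<delta>\<in>F'. B \<gamma> \<delta> * C \<delta> \<beta>)" if "\<gamma> \<in> F" for \<gamma>
    by (rule smat_mult_eq_sum[OF F']) (use that in \<open>auto simp: F'_def\<close>)
  have "((A \<odot> B) \<odot> C) \<alpha> \<beta> = (\<Sum>\<delta>\<in>F'. (A \<odot> B) \<alpha> \<delta> * C \<delta> \<beta>)"
    by (rule smat_mult_eq_sum[OF F']) (auto simp: AB F'_def intro!: sum.neutral)
  also have "\<dots> = (\<Sum>\<delta>\<in>F'. \<Sum>\<gamma>\<in>F. A \<alpha> \<gamma> * B \<gamma> \<delta> * C \<delta> \<beta>)"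
    by (simp add: AB sum_distrib_right)
  also have "\<dots> = (\<Sum>\<gamma>\<in>F. \<Sum>\<delta>\<in>F'. A \<alpha> \<gamma> * B \<gamma> \<delta> * C \<delta> \<beta>)"
    by (rule sum.swap)
  also have "\<dots> = (\<Sum>\<gamma>\<in>F. A \<alpha> \<gamma> * (B \<odot> C) \<gamma> \<beta>)"
    by (simp add: BC sum_distrib_left mult.assoc)
  also have "\<dots> = (A \<odot> (B \<odot> C)) \<alpha> \<beta>"
    unfolding F_def by (rule smat_mult_row_finite[OF A, symmetric])
  finally show "((A \<odot> B) \<odot> C) \<alpha> \<beta> = (A \<odot> (B \<odot> C)) \<alpha> \<beta>" .
qed

text \<open>Both sides sum the same products over the same set, so they also agree (both being 0) at
  entries with infinitely many nonzero terms.\<close>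

lemma smat_transpose_mult: "smat_transpose (A \<odot> B) = smat_transpose B \<odot> smat_transpose A"
  by (intro ext) (simp add: smat_transpose_def smat_mult_def mult.commute)

lemma smat_transpose_transpose [simp]: "smat_transpose (smat_transpose A) = A"
  by (simp add: smat_transpose_def)

lemma smat_transpose_scalar [simp]: "smat_transpose (smat_scalar c) = smat_scalar c"
  by (auto simp: smat_transpose_def smat_scalar_def fun_eq_iff)

text \<open>Mirror image of \<open>smat_mult_assoc\<close> under transposition, for products ending
  in transposed lower triangular factors, whose rows may be infinite.\<close>

lemma smat_mult_assoc_column_finite:
  assumes "row_finite (smat_transpose B)" and "row_finite (smat_transpose C)"
  shows "(A \<odot> B) \<odot> C = A \<odot> (B \<odot> C)"
proof -
  have "smat_transpose ((A \<odot> B) \<odot> C) = smat_transpose (A \<odot> (B \<odot> C))"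
    using smat_mult_assoc[OF assms(2,1)] by (simp add: smat_transpose_mult)
  then show ?thesis
    by (metis smat_transpose_transpose)
qed

lemma row_finite_scalar: "row_finite (smat_scalar c)"
  by (auto simp: row_finite_def smat_scalar_def)

lemma smat_mult_scalar_left: "smat_scalar c \<odot> A = (\<lambda>\<alpha> \<beta>. c * A \<alpha> \<beta>)"
proof (intro ext)
  fix \<alpha> \<beta>
  have "(smat_scalar c \<odot> A) \<alpha> \<beta> = (\<Sum>\<gamma>\<in>{\<alpha>}. smat_scalar c \<alpha> \<gamma> * A \<gamma> \<beta>)"
    by (rule smat_mult_eq_sum) (auto simp: smat_scalar_def)
  then show "(smat_scalar c \<odot> A) \<alpha> \<beta> = c * A \<alpha> \<beta>"
    by (simp add: smat_scalar_def)
qed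

lemma smat_mult_scalar_right: "A \<odot> smat_scalar c = (\<lambda>\<alpha> \<beta>. A \<alpha> \<beta> * c)"
proof (intro ext)
  fix \<alpha> \<beta>
  have "(A \<odot> smat_scalar c) \<alpha> \<beta> = (\<Sum>\<gamma>\<in>{\<beta>}. A \<alpha> \<gamma> * smat_scalar c \<gamma> \<beta>)"
    by (rule smat_mult_eq_sum) (auto simp: smat_scalar_def)
  then show "(A \<odot> smat_scalar c) \<alpha> \<beta> = A \<alpha> \<beta> * c"
    by (simp add: smat_scalar_def)
qed

lemma smat_mult_1 [simp]: "smat_scalar 1 \<odot> A = A" "A \<odot> smat_scalar 1 = A"
  by (simp_all add: smat_mult_scalar_left smat_mult_scalar_right)

section \<open>Distributivity over differences and finite linear combinations\<close>

lemma smat_mult_diff_right: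
  assumes "row_finite A"
  shows "A \<odot> (B - C) = A \<odot> B - A \<odot> C"
  by (intro ext) (simp add: smat_mult_row_finite[OF assms] right_diff_distrib sum_subtractf)

lemma smat_mult_diff_left:
  assumes "row_finite A" and "row_finite B"
  shows "(A - B) \<odot> C = A \<odot> C - B \<odot> C"
proof (intro ext)
  fix \<alpha> \<beta>
  define F where "F = {\<gamma>. A \<alpha> \<gamma> \<noteq> 0} \<union> {\<gamma>. B \<alpha> \<gamma> \<noteq> 0}"
  have F: "finite F"
    using assms by (auto simp: F_def row_finite_def)
  have "(X \<odot> C) \<alpha> \<beta> = (\<Sum>\<gamma>\<in>F. X \<alpha> \<gamma> * C \<gamma> \<beta>)" if "X \<in> {A, B, A - B}" for X
    by (rule smat_mult_eq_sum[OF F]) (use that in \<open>auto simp: F_def\<close>)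
  then show "((A - B) \<odot> C) \<alpha> \<beta> = (A \<odot> C - B \<odot> C) \<alpha> \<beta>"
    by (simp add: left_diff_distrib sum_subtractf)
qed

lemma row_finite_diff: "row_finite A \<Longrightarrow> row_finite B \<Longrightarrow> row_finite (A - B)"
  unfolding row_finite_def
proof
  fix \<alpha>
  assume "\<forall>\<alpha>. finite {\<gamma>. A \<alpha> \<gamma> \<noteq> 0}" and "\<forall>\<alpha>. finite {\<gamma>. B \<alpha> \<gamma> \<noteq> 0}"
  then have "finite ({\<gamma>. A \<alpha> \<gamma> \<noteq> 0} \<union> {\<gamma>. B \<alpha> \<gamma> \<noteq> 0})"
    by simp
  then show "finite {\<gamma>. (A - B) \<alpha> \<gamma> \<noteq> 0}"
    by (rule rev_finite_subset) auto
qed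

lemma smat_mult_sum_right:
  assumes "row_finite A"
  shows "A \<odot> (\<lambda>\<alpha> \<beta>. \<Sum>b\<in>I. c b * B b \<alpha> \<beta>) = (\<lambda>\<alpha> \<beta>. \<Sum>b\<in>I. c b * (A \<odot> B b) \<alpha> \<beta>)"
proof (intro ext)
  fix \<alpha> \<beta>
  have "(A \<odot> (\<lambda>\<alpha> \<beta>. \<Sum>b\<in>I. c b * B b \<alpha> \<beta>)) \<alpha> \<beta> =
      (\<Sum>\<gamma> | A \<alpha> \<gamma> \<noteq> 0. \<Sum>b\<in>I. c b * (A \<alpha> \<gamma> * B b \<gamma> \<beta>))"
    by (simp add: smat_mult_row_finite[OF assms] sum_distrib_left mult.left_commute)
  also have "\<dots> = (\<Sum>b\<in>I. c b * (A \<odot> B b) \<alpha> \<beta>)"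
    by (subst sum.swap) (simp add: smat_mult_row_finite[OF assms] sum_distrib_left)
  finally show "(A \<odot> (\<lambda>\<alpha> \<beta>. \<Sum>b\<in>I. c b * B b \<alpha> \<beta>)) \<alpha> \<beta> =
      (\<Sum>b\<in>I. c b * (A \<odot> B b) \<alpha> \<beta>)" .
qed

lemma smat_mult_sum_left:
  assumes "finite I" and "\<And>b. b \<in> I \<Longrightarrow> row_finite (B b)"
  shows "(\<lambda>\<alpha> \<beta>. \<Sum>b\<in>I. c b * B b \<alpha> \<beta>) \<odot> C = (\<lambda>\<alpha> \<beta>. \<Sum>b\<in>I. c b * (B b \<odot> C) \<alpha> \<beta>)"
proof (intro ext)
  fix \<alpha> \<beta>
  define F where "F = (\<Union>b\<in>I. {\<gamma>. B b \<alpha> \<gamma> \<noteq> 0})"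
  have F: "finite F"
    using assms by (auto simp: F_def row_finite_def)
  have B: "(B b \<odot> C) \<alpha> \<beta> = (\<Sum>\<gamma>\<in>F. B b \<alpha> \<gamma> * C \<gamma> \<beta>)" if "b \<in> I" for b
    by (rule smat_mult_eq_sum[OF F]) (use that in \<open>auto simp: F_def\<close>)
  have "((\<lambda>\<alpha> \<beta>. \<Sum>b\<in>I. c b * B b \<alpha> \<beta>) \<odot> C) \<alpha> \<beta> = (\<Sum>\<gamma>\<in>F. (\<Sum>b\<in>I. c b * B b \<alpha> \<gamma>) * C \<gamma> \<beta>)"
    by (rule smat_mult_eq_sum[OF F]) (auto simp: F_def intro!: sum.neutral)
  also have "\<dots> = (\<Sum>\<gamma>\<in>F. \<Sum>b\<in>I. c b * (B b \<alpha> \<gamma> * C \<gamma> \<beta>))"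
    by (simp add: sum_distrib_right mult.assoc)
  also have "\<dots> = (\<Sum>b\<in>I. c b * (\<Sum>\<gamma>\<in>F. B b \<alpha> \<gamma> * C \<gamma> \<beta>))"
    by (subst sum.swap) (simp add: sum_distrib_left)
  finally show "((\<lambda>\<alpha> \<beta>. \<Sum>b\<in>I. c b * B b \<alpha> \<beta>) \<odot> C) \<alpha> \<beta> = (\<Sum>b\<in>I. c b * (B b \<odot> C) \<alpha> \<beta>)"
    by (simp add: B)
qed

lemma row_finite_sum:
  assumes "finite I" and "\<And>b. b \<in> I \<Longrightarrow> row_finite (B b)"
  shows "row_finite (\<lambda>\<alpha> \<beta>. \<Sum>b\<in>I. c b * B b \<alpha> \<beta>)"
  unfolding row_finite_def
proof
  fix \<alpha>
  have "{\<gamma>. (\<Sum>b\<in>I. c b * B b \<alpha> \<gamma>) \<noteq> 0} \<subseteq> (\<Union>b\<in>I. {\<gamma>. B b \<alpha> \<gamma> \<noteq> 0})"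
    by (auto elim!: sum.not_neutral_contains_not_neutral)
  then show "finite {\<gamma>. (\<Sum>b\<in>I. c b * B b \<alpha> \<gamma>) \<noteq> 0}"
    by (rule finite_subset) (use assms in \<open>auto simp: row_finite_def\<close>)
qed

text \<open>Any competitor \<open>B\<close> equals
  \<open>(C \<odot> A) \<odot> B = C \<odot> (A \<odot> B) = C\<close>. The reassociation uses
  finite rows of \<open>C\<close> and \<open>A\<close> only, so it applies to every \<open>B\<close>
  that the choice in \<open>smat_inv\<close> could pick.\<close>

lemma smat_inv_eqI:
  assumes A: "row_finite A" and C: "row_finite C"
    and AC: "A \<odot> C = smat_scalar 1" and CA: "C \<odot> A = smat_scalar 1"
  shows "smat_inv A = C"
  unfolding smat_inv_def
proof (rule some_equality)
  show "smat_mult_defined A C \<and> smat_mult_defined C A \<and> A \<odot> C = smat_scalar 1 \<and> C \<odot> A = smat_scalar 1"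
    using assms by (simp add: smat_mult_defined_row_finite)
next
  fix B
  assume "smat_mult_defined A B \<and> smat_mult_defined B A \<and> A \<odot> B = smat_scalar 1 \<and> B \<odot> A = smat_scalar 1"
  then show "B = C"
    using smat_mult_assoc[OF C A, of B] by (simp add: CA)
qed

section \<open>Block triangular matrices\<close>

text \<open>Every coordinate is bounded by the degree, which leaves finitely many functions. This
  makes block lower matrices row-finite.\<close>

lemma finite_mdeg_le: "finite {\<alpha> :: 'd::finite midx. mdeg \<alpha> \<le> k}"
proof (rule finite_subset)
  show "{\<alpha> :: 'd midx. mdeg \<alpha> \<le> k} \<subseteq> vec_lambda ` (PiE UNIV (\<lambda>_. {..k}))"
  proof
    fix \<alpha> :: "'d midx"
    assume "\<alpha> \<in> {\<alpha>. mdeg \<alpha> \<le> k}"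
    then have "\<alpha> $ i \<le> k" for i
      using member_le_sum[of i UNIV "($) \<alpha>"] by (simp add: mdeg_def)
    then have "vec_nth \<alpha> \<in> PiE UNIV (\<lambda>_. {..k})"
      by auto
    then show "\<alpha> \<in> vec_lambda ` (PiE UNIV (\<lambda>_. {..k}))"
      by (metis image_eqI vec_nth_inverse)
  qed
  show "finite (vec_lambda ` (PiE UNIV (\<lambda>_. {..k})) :: 'd midx set)"
    by (intro finite_imageI finite_PiE) auto
qed

lemma block_lower_iff: "block_lower A \<longleftrightarrow> (\<forall>\<alpha> \<beta>. mdeg \<alpha> < mdeg \<beta> \<longrightarrow> A \<alpha> \<beta> = 0)"
  by (auto simp: block_lower_def midx_of_deg_def)

lemma block_upper_iff: "block_upper A \<longleftrightarrow> (\<forall>\<alpha> \<beta>. mdeg \<beta> < mdeg \<alpha> \<longrightarrow> A \<alpha> \<beta> = 0)"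
  by (auto simp: block_upper_def midx_of_deg_def)

lemma block_diagonal_iff: "block_diagonal A \<longleftrightarrow> (\<forall>\<alpha> \<beta>. mdeg \<alpha> \<noteq> mdeg \<beta> \<longrightarrow> A \<alpha> \<beta> = 0)"
  by (auto simp: block_diagonal_def midx_of_deg_def)

text \<open>Indices of different degree are distinct, so the zero blocks above the diagonal and the
  identity diagonal blocks form one condition.\<close>

lemma block_lower_unitriangular_iff:
  "block_lower_unitriangular A \<longleftrightarrow> (\<forall>\<alpha> \<beta>. mdeg \<alpha> \<le> mdeg \<beta> \<longrightarrow> A \<alpha> \<beta> = smat_scalar 1 \<alpha> \<beta>)"
proof
  assume "block_lower_unitriangular A"
  then show "\<forall>\<alpha> \<beta>. mdeg \<alpha> \<le> mdeg \<beta> \<longrightarrow> A \<alpha> \<beta> = smat_scalar 1 \<alpha> \<beta>"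
    by (auto simp: block_lower_unitriangular_def block_lower_iff midx_of_deg_def smat_scalar_def
        order_le_less)
qed (auto simp: block_lower_unitriangular_def block_lower_iff midx_of_deg_def smat_scalar_def)

lemma block_lower_row_finite: "block_lower A \<Longrightarrow> row_finite A"
  unfolding row_finite_def block_lower_iff
  by (intro allI rev_finite_subset[OF finite_mdeg_le]) (auto simp flip: not_less)

lemma block_diagonal_imp_lower: "block_diagonal A \<Longrightarrow> block_lower A"
  and block_diagonal_imp_upper: "block_diagonal A \<Longrightarrow> block_upper A"
  and block_diagonal_transpose: "block_diagonal A \<Longrightarrow> block_diagonal (smat_transpose A)"
  by (auto simp: block_diagonal_iff block_lower_iff block_upper_iff smat_transpose_def)

lemma block_lower_unitriangular_imp_lower: "block_lower_unitriangular A \<Longrightarrow> block_lower A"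
  by (simp add: block_lower_unitriangular_def)

lemma block_upper_transpose: "block_lower A \<Longrightarrow> block_upper (smat_transpose A)"
  by (simp add: block_lower_iff block_upper_iff smat_transpose_def)

text \<open>Below the block diagonal each single term has a zero factor, so no finiteness of the
  sums enters.\<close>

lemma block_upper_mult:
  assumes "block_upper A" and "block_upper B"
  shows "block_upper (A \<odot> B)"
  unfolding block_upper_iff
proof (intro allI impI)
  fix \<alpha> \<beta> :: "'a midx"
  assume "mdeg \<beta> < mdeg \<alpha>"
  then have "A \<alpha> \<gamma> * B \<gamma> \<beta> = 0" for \<gamma>
    using assms unfolding block_upper_iff
    by (cases "mdeg \<gamma> < mdeg \<alpha>") auto
  then show "(A \<odot> B) \<alpha> \<beta> = 0"
    unfolding smat_mult_def by (intro sum.neutral) simp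
qed

lemma block_lower_unitriangular_mult:
  assumes A: "block_lower_unitriangular A" and B: "block_lower_unitriangular B"
  shows "block_lower_unitriangular (A \<odot> B)"
  unfolding block_lower_unitriangular_iff
proof (intro allI impI)
  fix \<alpha> \<beta> :: "'a midx"
  assume le: "mdeg \<alpha> \<le> mdeg \<beta>"
  have "(A \<odot> B) \<alpha> \<beta> = (\<Sum>\<gamma>\<in>{\<alpha>}. A \<alpha> \<gamma> * B \<gamma> \<beta>)"
  proof (rule smat_mult_eq_sum)
    fix \<gamma>
    assume "\<gamma> \<notin> {\<alpha>}"
    then show "A \<alpha> \<gamma> * B \<gamma> \<beta> = 0"
      using A B le unfolding block_lower_unitriangular_iff
      by (cases "mdeg \<alpha> \<le> mdeg \<gamma>") (auto simp: smat_scalar_def)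
  qed simp
  then show "(A \<odot> B) \<alpha> \<beta> = smat_scalar 1 \<alpha> \<beta>"
    using A B le by (auto simp: block_lower_unitriangular_iff smat_scalar_def)
qed

text \<open>Forward substitution for \<open>A \<odot> X = smat_scalar 1\<close>, by increasing
  degree of the row index; diagonal blocks of \<open>A\<close> are taken to be identities.\<close>

function lower_inverse :: "'d::finite smat \<Rightarrow> 'd smat" where
  "lower_inverse A \<alpha> \<beta> =
     smat_scalar 1 \<alpha> \<beta> - (\<Sum>\<gamma> | mdeg \<gamma> < mdeg \<alpha>. A \<alpha> \<gamma> * lower_inverse A \<gamma> \<beta>)"
  by pat_completeness auto
termination
  by (relation "Wellfounded.measure (\<lambda>(A, \<alpha>, \<beta>). mdeg \<alpha>)") auto

declare lower_inverse.simps [simp del]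

lemma block_lower_unitriangular_lower_inverse: "block_lower_unitriangular (lower_inverse A)"
proof -
  have "mdeg \<alpha> \<le> mdeg \<beta> \<longrightarrow> lower_inverse A \<alpha> \<beta> = smat_scalar 1 \<alpha> \<beta>" for \<alpha> \<beta>
  proof (induction "mdeg \<alpha>" arbitrary: \<alpha> rule: less_induct)
    case less
    have "A \<alpha> \<gamma> * lower_inverse A \<gamma> \<beta> = 0" if "mdeg \<gamma> < mdeg \<alpha>" "mdeg \<alpha> \<le> mdeg \<beta>" for \<gamma>
      using that less[of \<gamma>] by (auto simp: smat_scalar_def)
    then show ?case
      by (subst lower_inverse.simps) (auto intro!: sum.neutral)
  qed
  then show ?thesis
    by (simp add: block_lower_unitriangular_iff)
qed

lemma lower_inverse_right:
  assumes "block_lower_unitriangular A"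
  shows "A \<odot> lower_inverse A = smat_scalar 1"
proof (intro ext)
  fix \<alpha> \<beta> :: "'a midx"
  have fin: "finite {\<gamma>. mdeg \<gamma> < mdeg \<alpha>}"
    by (rule finite_subset[OF _ finite_mdeg_le[of "mdeg \<alpha>"]]) auto
  have A: "A \<alpha> \<gamma> = smat_scalar 1 \<alpha> \<gamma>" if "mdeg \<alpha> \<le> mdeg \<gamma>" for \<gamma>
    using assms that by (simp add: block_lower_unitriangular_iff)
  have "(A \<odot> lower_inverse A) \<alpha> \<beta> =
      (\<Sum>\<gamma>\<in>insert \<alpha> {\<gamma>. mdeg \<gamma> < mdeg \<alpha>}. A \<alpha> \<gamma> * lower_inverse A \<gamma> \<beta>)"
    by (rule smat_mult_eq_sum) (use fin A in \<open>auto simp: smat_scalar_def not_less\<close>)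
  also have "\<dots> = lower_inverse A \<alpha> \<beta> + (\<Sum>\<gamma> | mdeg \<gamma> < mdeg \<alpha>. A \<alpha> \<gamma> * lower_inverse A \<gamma> \<beta>)"
    using fin A[of \<alpha>] by (subst sum.insert) (auto simp: smat_scalar_def)
  also have "\<dots> = smat_scalar 1 \<alpha> \<beta>"
    by (subst lower_inverse.simps) simp
  finally show "(A \<odot> lower_inverse A) \<alpha> \<beta> = smat_scalar 1 \<alpha> \<beta>" .
qed

text \<open>The right inverse \<open>C\<close> is again unitriangular and so has a right inverse
  \<open>D\<close>. Associativity gives
  \<open>D = (A \<odot> C) \<odot> D = A \<odot> (C \<odot> D) = A\<close>, whence \<open>C\<close>
  is also a left inverse.\<close>

lemma smat_inv_block_lower_unitriangular:
  assumes A: "block_lower_unitriangular A"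
  shows "block_lower_unitriangular (smat_inv A)"
    and "A \<odot> smat_inv A = smat_scalar 1" and "smat_inv A \<odot> A = smat_scalar 1"
proof -
  define C where "C = lower_inverse A"
  define D where "D = lower_inverse C"
  have C: "block_lower_unitriangular C"
    by (simp add: C_def block_lower_unitriangular_lower_inverse)
  have fin: "row_finite A" "row_finite C"
    using A C by (simp_all add: block_lower_row_finite block_lower_unitriangular_imp_lower)
  have AC: "A \<odot> C = smat_scalar 1" and CD: "C \<odot> D = smat_scalar 1"
    by (simp_all add: C_def D_def A lower_inverse_right block_lower_unitriangular_lower_inverse)
  have "D = A"
    using smat_mult_assoc[OF fin, of D] by (simp add: AC CD)
  then have "smat_inv A = C"
    using AC CD fin by (intro smat_inv_eqI) auto
  then show "block_lower_unitriangular (smat_inv A)"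
    and "A \<odot> smat_inv A = smat_scalar 1" and "smat_inv A \<odot> A = smat_scalar 1"
    using AC CD C \<open>D = A\<close> by simp_all
qed

text \<open>Inverses of the single blocks are glued together; products of block diagonal matrices
  reduce to finite sums within one degree.\<close>

lemma smat_inv_block_diagonal:
  assumes A: "block_diagonal A" and inv: "\<And>k. invertible_diag_block A k"
  shows "block_diagonal (smat_inv A)"
    and "A \<odot> smat_inv A = smat_scalar 1"
proof -
  define inverse_block where "inverse_block k B \<longleftrightarrow> (\<forall>\<alpha>\<in>midx_of_deg k. \<forall>\<beta>\<in>midx_of_deg k.
      (\<Sum>\<gamma>\<in>midx_of_deg k. A \<alpha> \<gamma> * B \<gamma> \<beta>) = smat_scalar 1 \<alpha> \<beta> \<and>
      (\<Sum>\<gamma>\<in>midx_of_deg k. B \<alpha> \<gamma> * A \<gamma> \<beta>) = smat_scalar 1 \<alpha> \<beta>)" for k B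
  have "\<exists>B. inverse_block k B" for k
    using inv[of k] by (simp add: invertible_diag_block_def inverse_block_def smat_scalar_def)
  then obtain B where "\<And>k. inverse_block k (B k)"
    by metis
  then have B: "(\<Sum>\<gamma>\<in>midx_of_deg (mdeg \<alpha>). A \<alpha> \<gamma> * B (mdeg \<alpha>) \<gamma> \<beta>) = smat_scalar 1 \<alpha> \<beta>"
      "(\<Sum>\<gamma>\<in>midx_of_deg (mdeg \<alpha>). B (mdeg \<alpha>) \<alpha> \<gamma> * A \<gamma> \<beta>) = smat_scalar 1 \<alpha> \<beta>"
    if "mdeg \<alpha> = mdeg \<beta>" for \<alpha> \<beta>
    using that by (simp_all add: inverse_block_def midx_of_deg_def)
  \<comment> \<open>Outside its own block \<open>B k\<close> is arbitrary, so only its block of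
    degree \<open>k\<close> is kept.\<close>
  define C where "C = (\<lambda>\<alpha> \<beta>. if mdeg \<alpha> = mdeg \<beta> then B (mdeg \<alpha>) \<alpha> \<beta> else 0)"
  have C: "block_diagonal C"
    by (simp add: block_diagonal_iff C_def)
  have fin: "finite (midx_of_deg k :: 'a midx set)" for k
    by (rule finite_subset[OF _ finite_mdeg_le[of k]]) (auto simp: midx_of_deg_def)
  have diagonal_mult: "(X \<odot> Y) \<alpha> \<beta> = (if mdeg \<alpha> = mdeg \<beta> then \<Sum>\<gamma>\<in>midx_of_deg (mdeg \<alpha>). X \<alpha> \<gamma> * Y \<gamma> \<beta> else 0)"
    if "block_diagonal X" "block_diagonal Y" for X Y :: "'a smat" and \<alpha> \<beta>
  proof -
    have "(X \<odot> Y) \<alpha> \<beta> = (\<Sum>\<gamma>\<in>midx_of_deg (mdeg \<alpha>). X \<alpha> \<gamma> * Y \<gamma> \<beta>)"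
      by (rule smat_mult_eq_sum[OF fin]) (use that in \<open>auto simp: block_diagonal_iff midx_of_deg_def\<close>)
    moreover have "(\<Sum>\<gamma>\<in>midx_of_deg (mdeg \<alpha>). X \<alpha> \<gamma> * Y \<gamma> \<beta>) = 0" if "mdeg \<alpha> \<noteq> mdeg \<beta>"
      using \<open>block_diagonal Y\<close> that by (intro sum.neutral) (auto simp: block_diagonal_iff midx_of_deg_def)
    ultimately show ?thesis
      by simp
  qed
  have AC: "A \<odot> C = smat_scalar 1"
  proof (intro ext)
    fix \<alpha> \<beta> :: "'a midx"
    have "(\<Sum>\<gamma>\<in>midx_of_deg (mdeg \<alpha>). A \<alpha> \<gamma> * C \<gamma> \<beta>) =
        (\<Sum>\<gamma>\<in>midx_of_deg (mdeg \<alpha>). A \<alpha> \<gamma> * B (mdeg \<alpha>) \<gamma> \<beta>)" if "mdeg \<alpha> = mdeg \<beta>"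
      using that by (intro sum.cong) (auto simp: C_def midx_of_deg_def)
    then show "(A \<odot> C) \<alpha> \<beta> = smat_scalar 1 \<alpha> \<beta>"
      using B[of \<alpha> \<beta>] by (auto simp: diagonal_mult A C smat_scalar_def)
  qed
  have CA: "C \<odot> A = smat_scalar 1"
  proof (intro ext)
    fix \<alpha> \<beta> :: "'a midx"
    have "(\<Sum>\<gamma>\<in>midx_of_deg (mdeg \<alpha>). C \<alpha> \<gamma> * A \<gamma> \<beta>) =
        (\<Sum>\<gamma>\<in>midx_of_deg (mdeg \<alpha>). B (mdeg \<alpha>) \<alpha> \<gamma> * A \<gamma> \<beta>)"
      by (intro sum.cong) (auto simp: C_def midx_of_deg_def)
    then show "(C \<odot> A) \<alpha> \<beta> = smat_scalar 1 \<alpha> \<beta>"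
      using B[of \<alpha> \<beta>] by (auto simp: diagonal_mult A C smat_scalar_def)
  qed
  have "smat_inv A = C"
    using A C AC CA by (intro smat_inv_eqI block_lower_row_finite block_diagonal_imp_lower)
  then show "block_diagonal (smat_inv A)" and "A \<odot> smat_inv A = smat_scalar 1"
    using C AC by simp_all
qed

section \<open>Shift matrices\<close>

text \<open>The matrix n \<cdot> \<Lambda> - c, which represents multiplication by the polynomial n
  \<cdot> x - c on the vector of monomials.\<close>

definition spectral_shift :: "real ^ 'd \<Rightarrow> real \<Rightarrow> 'd::finite smat" where
  "spectral_shift n c = (\<lambda>\<alpha> \<beta>. \<Sum>b\<in>UNIV. n $ b * Lambda b \<alpha> \<beta>) - smat_scalar c"

lemma row_finite_Lambda: "row_finite (Lambda b)"
  by (auto simp: row_finite_def Lambda_def)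

lemma row_finite_spectral_shift: "row_finite (spectral_shift n c)"
  unfolding spectral_shift_def
  by (intro row_finite_diff row_finite_sum row_finite_Lambda row_finite_scalar) simp

lemma Lambda_mult: "(Lambda b \<odot> A) \<alpha> \<beta> = A (\<alpha> + axis b 1) \<beta>"
proof -
  have "(Lambda b \<odot> A) \<alpha> \<beta> = (\<Sum>\<gamma>\<in>{\<alpha> + axis b 1}. Lambda b \<alpha> \<gamma> * A \<gamma> \<beta>)"
    by (rule smat_mult_eq_sum) (auto simp: Lambda_def)
  then show ?thesis
    by (simp add: Lambda_def)
qed

lemma spectral_shift_mult:
  "(spectral_shift n c \<odot> A) \<alpha> \<beta> = (\<Sum>b\<in>UNIV. n $ b * A (\<alpha> + axis b 1) \<beta>) - c * A \<alpha> \<beta>"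
  by (simp add: spectral_shift_def smat_mult_diff_left row_finite_sum row_finite_Lambda
      row_finite_scalar smat_mult_sum_left Lambda_mult smat_mult_scalar_left)

text \<open>Conjugation by \<open>S m\<close> is linear and fixes scalar matrices, so the
  combination of shifts and the subtraction of \<open>c\<close> can be done before
  conjugating.\<close>

lemma dot_jacobi_minus_scalar:
  assumes "block_lower_unitriangular (S m)"
  shows "dot_jacobi n S m - smat_scalar c = S m \<odot> spectral_shift n c \<odot> smat_inv (S m)"
proof -
  have fin: "row_finite (S m)"
    using assms by (simp add: block_lower_row_finite block_lower_unitriangular_imp_lower)
  have "S m \<odot> smat_scalar c \<odot> smat_inv (S m) = smat_scalar c \<odot> S m \<odot> smat_inv (S m)"
    by (simp add: smat_mult_scalar_left smat_mult_scalar_right mult.commute)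
  also have "\<dots> = smat_scalar c"
    by (simp add: smat_mult_assoc fin row_finite_scalar smat_inv_block_lower_unitriangular[OF assms])
  finally show ?thesis
    by (simp add: spectral_shift_def dot_jacobi_def jacobi_def smat_mult_diff_right smat_mult_diff_left
        smat_mult_sum_right smat_mult_sum_left row_finite_mult row_finite_sum row_finite_Lambda
        row_finite_scalar fin)
qed

section \<open>Deformed moments\<close>

lemma closed_measure_support: "closed (measure_support \<mu>)"
proof -
  have "- measure_support \<mu> = \<Union>{U. open U \<and> emeasure \<mu> U = 0}"
    by (auto simp: measure_support_def)
  then show ?thesis
    unfolding closed_def by auto
qed

text \<open>A point outside the support has a null basic neighbourhood; a countable basis provides
  only countably many of these, and their union is null.\<close>

lemma AE_in_measure_support:
  fixes \<mu> :: "'a::second_countable_topology measure"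
  assumes sets: "sets \<mu> = sets borel"
  shows "AE x in \<mu>. x \<in> measure_support \<mu>"
proof -
  obtain \<B> :: "'a set set" where \<B>: "countable \<B>" "topological_basis \<B>"
    using ex_countable_basis by blast
  define \<N> where "\<N> = {U \<in> \<B>. emeasure \<mu> U = 0}"
  have "\<N> \<subseteq> null_sets \<mu>"
    using \<B> by (auto simp: \<N>_def null_sets_def sets topological_basis_open)
  moreover have "countable \<N>"
    using \<B> by (simp add: \<N>_def)
  ultimately have "\<Union>\<N> \<in> null_sets \<mu>"
    using null_sets_UN'[of \<N> id \<mu>] by auto
  moreover have "{x \<in> space \<mu>. x \<notin> measure_support \<mu>} \<subseteq> \<Union>\<N>"
  proof
    fix x
    assume "x \<in> {x \<in> space \<mu>. x \<notin> measure_support \<mu>}"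
    then obtain U where U: "open U" "x \<in> U" "emeasure \<mu> U = 0"
      by (auto simp: measure_support_def)
    then obtain V where V: "V \<in> \<B>" "x \<in> V" "V \<subseteq> U"
      using \<B> topological_basisE by metis
    moreover have "emeasure \<mu> V \<le> emeasure \<mu> U"
      using U V by (intro emeasure_mono) (auto simp: sets)
    ultimately show "x \<in> \<Union>\<N>"
      using U by (auto simp: \<N>_def)
  qed
  ultimately show ?thesis
    by (rule AE_I')
qed

text \<open>In the coordinates \<open>N *v x\<close> the set is a box, and the inverse linear map
  carries it back to a bounded set.\<close>

lemma bounded_slab_intersection:
  fixes N :: "real ^ 'd ^ 'd::finite"
  assumes "invertible N"
  shows "bounded {x. \<forall>c. \<bar>N $ c \<bullet> x\<bar> < \<bar>q $ c\<bar>}"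
proof -
  obtain B where B: "B ** N = mat 1"
    using assms by (auto simp: invertible_def)
  have "{y :: real ^ 'd. \<forall>c. \<bar>y $ c\<bar> < \<bar>q $ c\<bar>} \<subseteq> cbox (\<chi> c. - \<bar>q $ c\<bar>) (\<chi> c. \<bar>q $ c\<bar>)"
  proof
    fix y :: "real ^ 'd"
    assume "y \<in> {y. \<forall>c. \<bar>y $ c\<bar> < \<bar>q $ c\<bar>}"
    then have y: "\<bar>y $ c\<bar> < \<bar>q $ c\<bar>" for c
      by simp
    have "- \<bar>q $ c\<bar> \<le> y $ c \<and> y $ c \<le> \<bar>q $ c\<bar>" for c
      using y[of c] by linarith
    then show "y \<in> cbox (\<chi> c. - \<bar>q $ c\<bar>) (\<chi> c. \<bar>q $ c\<bar>)"
      by (simp add: mem_box_cart)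
  qed
  then have "bounded {y :: real ^ 'd. \<forall>c. \<bar>y $ c\<bar> < \<bar>q $ c\<bar>}"
    by (rule bounded_subset[OF bounded_cbox])
  then have "bounded ((\<lambda>y. B *v y) ` {y. \<forall>c. \<bar>y $ c\<bar> < \<bar>q $ c\<bar>})"
    by (rule bounded_linear_image) (rule matrix_vector_mul_bounded_linear)
  moreover have "{x. \<forall>c. \<bar>N $ c \<bullet> x\<bar> < \<bar>q $ c\<bar>} \<subseteq> (\<lambda>y. B *v y) ` {y. \<forall>c. \<bar>y $ c\<bar> < \<bar>q $ c\<bar>}"
  proof
    fix x
    assume "x \<in> {x. \<forall>c. \<bar>N $ c \<bullet> x\<bar> < \<bar>q $ c\<bar>}"
    then have "N *v x \<in> {y. \<forall>c. \<bar>y $ c\<bar> < \<bar>q $ c\<bar>}"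
      by (simp add: matrix_vector_mul_component)
    moreover have "x = B *v (N *v x)"
      by (simp add: matrix_vector_mul_assoc B)
    ultimately show "x \<in> (\<lambda>y. B *v y) ` {y. \<forall>c. \<bar>y $ c\<bar> < \<bar>q $ c\<bar>}"
      by blast
  qed
  ultimately show ?thesis
    by (rule bounded_subset)
qed

section \<open>Monomials, the deforming density and its integrals\<close>

lemma monomial_add: "monomial (\<alpha> + \<beta>) x = monomial \<alpha> x * monomial \<beta> x"
  by (simp add: monomial_def power_add prod.distrib)

lemma monomial_axis: "monomial (axis b 1) x = x $ b"
proof -
  have "monomial (axis b 1) x = (\<Prod>i\<in>UNIV. if i = b then x $ i else 1)"
    unfolding monomial_def by (rule prod.cong) (auto simp: axis_def)
  then show ?thesis
    by simp
qed

text \<open>Raising an integer exponent by one multiplies by the base when the base is nonzero. At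
  base 0 this fails for exponent -1, since \<open>0 powi 0\<close> is 1.\<close>

lemma deformation_shift:
  assumes "N $ a \<bullet> x \<noteq> q $ a"
  shows "deformation N q (m + axis a 1) x = (N $ a \<bullet> x - q $ a) * deformation N q m x"
proof -
  have "deformation N q (m + axis a 1) x =
      (\<Prod>c\<in>UNIV. (if c = a then N $ a \<bullet> x - q $ a else 1) * (N $ c \<bullet> x - q $ c) powi (m $ c))"
    unfolding deformation_def
    by (rule prod.cong) (use assms in \<open>auto simp: axis_def power_int_add_1 mult.commute\<close>)
  also have "\<dots> = (N $ a \<bullet> x - q $ a) * deformation N q m x"
    by (simp add: prod.distrib deformation_def)
  finally show ?thesis .
qed

lemma borel_measurable_deformation: "deformation N q m \<in> borel_measurable borel"
  unfolding deformation_def power_int_def by measurable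

text \<open>The support is closed and bounded, hence compact, and no base of the density vanishes on
  it. The density is thus continuous and bounded there, and the integrand is dominated almost
  everywhere by a multiple of the monomial.\<close>

lemma integrable_monomial_deformation:
  fixes N :: "real ^ 'd ^ 'd::finite"
  assumes N: "invertible N"
    and sets: "sets \<mu> = sets borel"
    and moments: "finite_moments \<mu>"
    and supp: "measure_support \<mu> \<subseteq> {x. \<forall>c. \<bar>N $ c \<bullet> x\<bar> < \<bar>q $ c\<bar>}"
  shows "integrable \<mu> (\<lambda>x. monomial \<alpha> x * deformation N q m x)"
proof -
  have "compact (measure_support \<mu>)"
    using closed_measure_support bounded_subset[OF bounded_slab_intersection[OF N] supp]
    by (simp add: compact_eq_bounded_closed)
  moreover have "continuous_on (measure_support \<mu>) (deformation N q m)"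
  proof -
    have "N $ c \<bullet> x - q $ c \<noteq> 0" if "x \<in> measure_support \<mu>" for c x
    proof -
      have "\<bar>N $ c \<bullet> x\<bar> < \<bar>q $ c\<bar>"
        using supp that by auto
      then show ?thesis
        by auto
    qed
    then show ?thesis
      unfolding deformation_def by (intro continuous_intros) auto
  qed
  ultimately have "bounded (deformation N q m ` measure_support \<mu>)"
    by (intro compact_imp_bounded compact_continuous_image)
  then obtain C where C: "\<And>x. x \<in> measure_support \<mu> \<Longrightarrow> \<bar>deformation N q m x\<bar> \<le> C"
    by (auto simp: bounded_iff)
  have int: "integrable \<mu> (monomial \<alpha>)"
    using moments by (simp add: finite_moments_def)
  show ?thesis
  proof (rule Bochner_Integration.integrable_bound)
    show "integrable \<mu> (\<lambda>x. C * monomial \<alpha> x)"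
      using int by simp
    have "deformation N q m \<in> borel_measurable \<mu>"
      using borel_measurable_deformation measurable_cong_sets[OF sets refl] by blast
    then show "(\<lambda>x. monomial \<alpha> x * deformation N q m x) \<in> borel_measurable \<mu>"
      using borel_measurable_integrable[OF int] by (intro borel_measurable_times)
    show "AE x in \<mu>. norm (monomial \<alpha> x * deformation N q m x) \<le> norm (C * monomial \<alpha> x)"
      using AE_in_measure_support[OF sets]
    proof eventually_elim
      case (elim x)
      have "\<bar>monomial \<alpha> x\<bar> * \<bar>deformation N q m x\<bar> \<le> \<bar>monomial \<alpha> x\<bar> * \<bar>C\<bar>"
        using C[OF elim] by (intro mult_left_mono) auto
      then show ?case
        by (simp add: abs_mult mult.commute)
    qed
  qed
qed

lemma shift_moment_matrix:
  fixes N :: "real ^ 'd ^ 'd::finite"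
  assumes N: "invertible N"
    and sets: "sets \<mu> = sets borel"
    and moments: "finite_moments \<mu>"
    and supp: "measure_support \<mu> \<subseteq> {x. \<forall>c. \<bar>N $ c \<bullet> x\<bar> < \<bar>q $ c\<bar>}"
  shows "shift a (moment_matrix \<mu> N q) m =
    spectral_shift (N $ a) (q $ a) \<odot> moment_matrix \<mu> N q m"
proof (intro ext)
  fix \<alpha> \<beta>
  \<comment> \<open>The column index \<beta> stays fixed, because left multiplication by the shift
    moves only the row index.\<close>
  let ?f = "\<lambda>\<alpha> x. monomial \<alpha> x * monomial \<beta> x * deformation N q m x"
  have int: "integrable \<mu> (?f \<alpha>)" for \<alpha>
    using integrable_monomial_deformation[OF assms, of "\<alpha> + \<beta>" m] by (simp add: monomial_add)
  \<comment> \<open>Each coordinate of x is absorbed into the row monomial, raising \<alpha> by a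
    unit vector. The identity is claimed only almost everywhere, as it relies on avoiding the
    hyperplane where the new factor vanishes.\<close>
  have "AE x in \<mu>. monomial \<alpha> x * monomial \<beta> x * deformation N q (m + axis a 1) x =
      (\<Sum>b\<in>UNIV. N $ a $ b * ?f (\<alpha> + axis b 1) x) - q $ a * ?f \<alpha> x"
    using AE_in_measure_support[OF sets]
  proof eventually_elim
    case (elim x)
    have "\<bar>N $ a \<bullet> x\<bar> < \<bar>q $ a\<bar>"
      using supp elim by auto
    then have "N $ a \<bullet> x \<noteq> q $ a"
      by auto
    then have deformed: "deformation N q (m + axis a 1) x =
        ((\<Sum>b\<in>UNIV. N $ a $ b * x $ b) - q $ a) * deformation N q m x"
      by (simp add: deformation_shift inner_vec_def)
    have expanded: "(\<Sum>b\<in>UNIV. N $ a $ b * ?f (\<alpha> + axis b 1) x) =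
        (\<Sum>b\<in>UNIV. N $ a $ b * x $ b) * ?f \<alpha> x"
      unfolding sum_distrib_right monomial_add monomial_axis by (simp add: ac_simps)
    show ?case
      unfolding deformed expanded by (simp add: algebra_simps)
  qed
  moreover have "integrable \<mu> (\<lambda>x. monomial \<alpha> x * monomial \<beta> x * deformation N q (m + axis a 1) x)"
    using integrable_monomial_deformation[OF assms, of "\<alpha> + \<beta>"] by (simp only: monomial_add)
  moreover have "integrable \<mu> (\<lambda>x. (\<Sum>b\<in>UNIV. N $ a $ b * ?f (\<alpha> + axis b 1) x) - q $ a * ?f \<alpha> x)"
    by (intro Bochner_Integration.integrable_diff Bochner_Integration.integrable_sum
        integrable_mult_right int)
  ultimately have "shift a (moment_matrix \<mu> N q) m \<alpha> \<beta> =
      (\<integral>x. (\<Sum>b\<in>UNIV. N $ a $ b * ?f (\<alpha> + axis b 1) x) - q $ a * ?f \<alpha> x \<partial>\<mu>)"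
    unfolding shift_def moment_matrix_def
    by (intro integral_cong_AE borel_measurable_integrable)
  also have "\<dots> = (\<Sum>b\<in>UNIV. N $ a $ b * moment_matrix \<mu> N q m (\<alpha> + axis b 1) \<beta>)
      - q $ a * moment_matrix \<mu> N q m \<alpha> \<beta>"
    using int by (simp add: moment_matrix_def Bochner_Integration.integral_diff
        Bochner_Integration.integral_sum)
  also have "\<dots> = (spectral_shift (N $ a) (q $ a) \<odot> moment_matrix \<mu> N q m) \<alpha> \<beta>"
    by (simp add: spectral_shift_mult)
  finally show "shift a (moment_matrix \<mu> N q) m \<alpha> \<beta> =
      (spectral_shift (N $ a) (q $ a) \<odot> moment_matrix \<mu> N q m) \<alpha> \<beta>" .
qed

section \<open>The factorizations\<close>

theorem proposition3p1p7:
  fixes N :: "real ^ 'd ^ 'd::finite"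
    and q :: "real ^ 'd"
    and \<mu> :: "(real ^ 'd) measure"
    and S H :: "int ^ 'd \<Rightarrow> 'd smat"
    and m :: "int ^ 'd"
    and a :: 'd
  assumes "invertible N"
    and "\<And>c. q $ c \<noteq> 0"
    and "sets \<mu> = sets borel"
    and "finite_moments \<mu>"
    and "measure_support \<mu> \<subseteq> {x. \<forall>c. \<bar>N $ c \<bullet> x\<bar> < \<bar>q $ c\<bar>}"
    and "block_cholesky (moment_matrix \<mu> N q m) (S m) (H m)"
    and "block_cholesky (shift a (moment_matrix \<mu> N q) m) (shift a S m) (shift a H m)"
  shows "block_LU (dot_jacobi (N $ a) S m - smat_scalar (q $ a))
           (M_matrix a S m) (lattice_resolvent a S H m)
       \<and> block_UL (shift a (dot_jacobi (N $ a) S) m - smat_scalar (q $ a))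
           (lattice_resolvent a S H m) (M_matrix a S m)"
proof -
  define L where "L = spectral_shift (N $ a) (q $ a)"
  define s h s' h' where "s = S m" and "h = H m" and "s' = shift a S m" and "h' = shift a H m"
  define A A' where "A = smat_inv s" and "A' = smat_inv s'"
  define M \<omega> where "M = M_matrix a S m" and "\<omega> = lattice_resolvent a S H m"
  have s: "block_lower_unitriangular s" and s': "block_lower_unitriangular s'"
    and h: "block_diagonal h" and h': "block_diagonal h'"
    and h_inv: "\<And>k. invertible_diag_block h k"
    and G: "moment_matrix \<mu> N q m = A \<odot> h \<odot> smat_transpose A"
    and G': "shift a (moment_matrix \<mu> N q) m = A' \<odot> h' \<odot> smat_transpose A'"
    using assms(6,7) by (simp_all add: block_cholesky_def s_def s'_def h_def h'_def A_def A'_def)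
  note A = smat_inv_block_lower_unitriangular[OF s, folded A_def]
  note A' = smat_inv_block_lower_unitriangular[OF s', folded A'_def]
  note hi = smat_inv_block_diagonal[OF h h_inv]
  have M_eq: "M = s \<odot> A'"
    by (simp add: M_def M_matrix_def s_def s'_def A'_def)
  have M: "block_lower_unitriangular M"
    unfolding M_eq by (rule block_lower_unitriangular_mult[OF s A'(1)])
  have \<omega>_eq: "\<omega> = h' \<odot> smat_transpose M \<odot> smat_inv h"
    by (simp add: \<omega>_def lattice_resolvent_def M_def h_def h'_def)
  \<comment> \<open>Triangularity is read off the definition of \<omega>; the later formula
    \<open>s' \<odot> L \<odot> A\<close> does not display it.\<close>
  have upper: "block_upper \<omega>"
    unfolding \<omega>_eq using h' M hi(1)
    by (intro block_upper_mult block_upper_transpose block_diagonal_imp_upper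
        block_lower_unitriangular_imp_lower)
  have fin: "row_finite L" "row_finite s" "row_finite s'" "row_finite h" "row_finite h'"
      "row_finite A" "row_finite A'" "row_finite (smat_transpose (smat_inv h))"
    using s s' A(1) A'(1) h h' hi(1)
    by (simp_all add: L_def row_finite_spectral_shift block_lower_row_finite
        block_lower_unitriangular_imp_lower block_diagonal_imp_lower block_diagonal_transpose)
  have *: "A' \<odot> h' \<odot> smat_transpose A' = L \<odot> (A \<odot> h \<odot> smat_transpose A)"
    using shift_moment_matrix[OF assms(1,3,4,5), of a m] by (simp add: G G' L_def)
  \<comment> \<open>Inserting \<open>s' \<odot> A' = smat_scalar 1\<close> on the left isolates
    \<open>h' \<odot> smat_transpose A'\<close> in the moment identity.\<close>
  have "h' \<odot> smat_transpose A' = s' \<odot> A' \<odot> (h' \<odot> smat_transpose A')"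
    by (simp add: A')
  also have "\<dots> = s' \<odot> (A' \<odot> h' \<odot> smat_transpose A')"
    by (simp add: smat_mult_assoc fin row_finite_mult)
  also have "\<dots> = s' \<odot> L \<odot> A \<odot> h \<odot> smat_transpose A"
    by (simp add: * smat_mult_assoc fin row_finite_mult)
  \<comment> \<open>Multiplying by \<open>smat_transpose s\<close> on the right will cancel
    \<open>smat_transpose A\<close>. Reassociation here rests on finite columns.\<close>
  finally have "h' \<odot> smat_transpose A' \<odot> smat_transpose s =
      s' \<odot> L \<odot> A \<odot> h \<odot> (smat_transpose A \<odot> smat_transpose s)"
    by (simp add: smat_mult_assoc_column_finite fin)
  moreover have "smat_transpose A \<odot> smat_transpose s = smat_scalar 1"
    by (simp add: A flip: smat_transpose_mult)
  ultimately have "h' \<odot> smat_transpose M = s' \<odot> L \<odot> A \<odot> h"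
    using smat_mult_assoc_column_finite[of "smat_transpose A'" "smat_transpose s" h'] fin
    by (simp add: M_eq smat_transpose_mult)
  \<comment> \<open>The trailing \<open>h\<close> cancels against \<open>smat_inv h\<close>.\<close>
  then have \<omega>: "\<omega> = s' \<odot> L \<odot> A"
    by (simp add: \<omega>_eq smat_mult_assoc fin row_finite_mult hi)
  have "M \<odot> \<omega> = s \<odot> (A' \<odot> s') \<odot> L \<odot> A"
    unfolding M_eq \<omega> by (simp add: smat_mult_assoc fin row_finite_mult del: smat_mult_1)
  then have LU: "dot_jacobi (N $ a) S m - smat_scalar (q $ a) = M \<odot> \<omega>"
    using s by (simp add: A' dot_jacobi_minus_scalar s_def A_def L_def)
  have "\<omega> \<odot> M = s' \<odot> L \<odot> (A \<odot> s) \<odot> A'"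
    unfolding M_eq \<omega> by (simp add: smat_mult_assoc fin row_finite_mult)
  then have UL: "shift a (dot_jacobi (N $ a) S) m - smat_scalar (q $ a) = \<omega> \<odot> M"
    using s' by (simp add: A dot_jacobi_minus_scalar s'_def A'_def L_def shift_def)
  \<comment> \<open>A block upper matrix may have infinite rows, but the formula for \<omega> shows
    finite ones, so the UL product is defined too.\<close>
  have "smat_mult_defined M \<omega>" "smat_mult_defined \<omega> M"
    unfolding M_eq \<omega> by (simp_all add: smat_mult_defined_row_finite fin row_finite_mult)
  then show ?thesis
    unfolding block_LU_def block_UL_def
    using M upper LU UL by (simp add: M_def \<omega>_def)
qed

end
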